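(* Let $\ell \geq 3$ and let $G$ be a disperse $\ell$-graph. Then for every tight component $\mathcal{C}$ of $G$, there is $U \subseteq V(G)$ such that $\mathcal{C} = \binom{U}{\ell-1}$.
   Context: All hypergraphs are finite. An $\ell$-graph $G$ is an $\ell$-uniform hypergraph with vertex set $V(G)$ and edge set $E(G) \subseteq \binom{V(G)}{\ell}$. For $X \subseteq V(G)$, $e_G(X)$ is the number of edges of $G$ contained in $X$. For $\ell \geq 3$, an $\ell$-graph $G$ is disperse if $e_G(X) \in \{0, 1, \ell, \ell+1\}$ for every $(\ell+1)$-set $X \subseteq V(G)$. A tight walk in $G$ is a sequence of edges $e_1, \dots, e_m \in E(G)$ ($m \geq 1$) such that $|e_i \cap e_{i+1}| \geq \ell-1$ for all $1 \leq i \leq m-1$. Sets $A, B \in \binom{V(G)}{\ell-1}$ are connected in $G$ if $A = B$ or there is a tight walk $e_1, \dots, e_m$ in $G$ with $A \subseteq e_1$ and $B \subseteq e_m$; this is an equivalence relation on $\binom{V(G)}{\ell-1}$. A tight component of $G$ is an equivalence class of this relation; thus the tight components partition $\binom{V(G)}{\ell-1}$. *)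

theory Defs
  imports "HOL-Library.Ramsey"
begin

text \<open>
  A hypergraph is a pair of a vertex set \<open>V\<close> and an edge set \<open>E\<close>; the uniformity
  \<open>l\<close> is an explicit parameter. The library notation \<open>[V]\<^bsup>l\<^esup>\<close> denotes the family
  of \<open>l\<close>-element subsets of \<open>V\<close>.
\<close>

definition uniform_hypergraph :: "nat \<Rightarrow> 'a set \<Rightarrow> 'a set set \<Rightarrow> bool" where
  "uniform_hypergraph l V E \<longleftrightarrow> finite V \<and> E \<subseteq> [V]\<^bsup>l\<^esup>"

definition edges_within :: "'a set set \<Rightarrow> 'a set \<Rightarrow> nat" where
  "edges_within E X = card {e \<in> E. e \<subseteq> X}"

definition disperse :: "nat \<Rightarrow> 'a set \<Rightarrow> 'a set set \<Rightarrow> bool" where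
  "disperse l V E \<longleftrightarrow> (\<forall>X \<in> [V]\<^bsup>(l + 1)\<^esup>. edges_within E X \<in> {0, 1, l, l + 1})"

definition tight_walk :: "nat \<Rightarrow> 'a set set \<Rightarrow> 'a set list \<Rightarrow> bool" where
  "tight_walk l E es \<longleftrightarrow> es \<noteq> [] \<and> set es \<subseteq> E \<and>
     (\<forall>i. i + 1 < length es \<longrightarrow> card (es ! i \<inter> es ! (i + 1)) \<ge> l - 1)"

definition tightly_connected :: "nat \<Rightarrow> 'a set \<Rightarrow> 'a set set \<Rightarrow> ('a set \<times> 'a set) set" where
  "tightly_connected l V E =
     {(A, B). A \<in> [V]\<^bsup>(l - 1)\<^esup> \<and> B \<in> [V]\<^bsup>(l - 1)\<^esup> \<and>
        (A = B \<or> (\<exists>es. tight_walk l E es \<and> A \<subseteq> hd es \<and> B \<subseteq> last es))}"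

definition tight_components :: "nat \<Rightarrow> 'a set \<Rightarrow> 'a set set \<Rightarrow> 'a set set set" where
  "tight_components l V E = [V]\<^bsup>(l - 1)\<^esup> // tightly_connected l V E"

end

theory Submission
  imports Defs
begin

text \<open>
  Call \<open>U\<close> linked if any two \<open>(l-1)\<close>-subsets of \<open>U\<close> are connected through edges inside \<open>U\<close>.
  An \<open>(l-1)\<close>-set is trivially linked, and the heart of the matter is that a linked \<open>U\<close> stays
  linked when a vertex \<open>v\<close> is added for which some edge \<open>insert v A\<close> has \<open>A \<subseteq> U\<close>. Indeed, the
  \<open>(l-1)\<close>-subsets of \<open>U\<close> that lie in the link of \<open>v\<close>, or in an edge inside \<open>U\<close> one of whose
  \<open>(l-1)\<close>-subsets lies in that link, are closed under passing from one \<open>(l-1)\<close>-subset of an edge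
  inside \<open>U\<close> to another, hence are all of them. In an edge of the latter kind, dispersity puts all
  but at most one \<open>(l-1)\<close>-subset in the link of \<open>v\<close>, so every \<open>(l-2)\<close>-subset of \<open>U\<close> together
  with \<open>v\<close> is covered by an edge. A maximal linked set is therefore closed under tight walks.
\<close>

locale disperse_hypergraph =
  fixes l :: nat and V :: "'a set" and E :: "'a set set"
  assumes l_ge: "l \<ge> 3"
    and uniform: "uniform_hypergraph l V E"
    and disperse: "disperse l V E"
begin

section \<open>Consequences of dispersity for a single (l+1)-set\<close>

lemma finite_V: "finite V"
  using uniform by (simp add: uniform_hypergraph_def)

lemma edgeD:
  assumes "e \<in> E"
  shows "e \<subseteq> V" "finite e" "card e = l"
  using assms uniform by (auto simp: uniform_hypergraph_def nsets_def)

text \<open>Two edges inside \<open>X\<close> rule out the counts 0 and 1, so dispersity forces at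
  least \<open>l\<close> of the \<open>l + 1\<close> candidates \<open>X - {z}\<close> to be
  edges.\<close>

lemma at_most_one_nonedge:
  assumes X: "X \<in> [V]\<^bsup>(l + 1)\<^esup>"
    and pq: "p \<in> X" "q \<in> X" "p \<noteq> q" "X - {p} \<in> E" "X - {q} \<in> E"
    and xy: "x \<in> X" "y \<in> X" "x \<noteq> y" "X - {x} \<notin> E"
  shows "X - {y} \<in> E"
proof (rule ccontr)
  assume y: "X - {y} \<notin> E"
  have fX: "finite X" "card X = l + 1"
    using X by (auto simp: nsets_def)
  let ?F = "{e \<in> E. e \<subseteq> X}"
  have finF: "finite ?F"
    using fX(1) by (auto intro: finite_subset[of _ "Pow X"])
  have "X - {p} \<noteq> X - {q}"
    using pq(1-3) by blast
  then have "card {X - {p}, X - {q}} = 2" by simp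
  moreover have "{X - {p}, X - {q}} \<subseteq> ?F"
    using pq by auto
  ultimately have "2 \<le> card ?F"
    using card_mono[OF finF] by metis
  then have "l \<le> card ?F"
    using disperse X by (auto simp: disperse_def edges_within_def)
  moreover have "?F \<subseteq> (\<lambda>z. X - {z}) ` (X - {x, y})"
  proof
    fix e assume e: "e \<in> ?F"
    then have "card (X - e) = 1"
      using edgeD[of e] fX by (simp add: card_Diff_subset)
    then obtain z where "X - e = {z}" by (rule card_1_singletonE)
    then have "e = X - {z}" "z \<in> X" using e by auto
    then show "e \<in> (\<lambda>z. X - {z}) ` (X - {x, y})"
      using e xy(4) y by auto
  qed
  then have "card ?F \<le> card (X - {x, y})"
    using fX(1) by (meson card_image_le card_mono finite_Diff finite_imageI le_trans)
  moreover have "card (X - {x, y}) = l - 1"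
    using xy fX by (simp add: card_Diff_subset)
  ultimately show False
    using l_ge by simp
qed

section \<open>Connectivity through edges inside a vertex set\<close>

definition adj_in :: "'a set \<Rightarrow> 'a set \<Rightarrow> 'a set \<Rightarrow> bool" where
  "adj_in U A B \<longleftrightarrow> A \<in> [U]\<^bsup>(l - 1)\<^esup> \<and> B \<in> [U]\<^bsup>(l - 1)\<^esup> \<and>
     (\<exists>e\<in>E. e \<subseteq> U \<and> A \<subseteq> e \<and> B \<subseteq> e)"

text \<open>The edges used must lie inside \<open>U\<close>, not just in \<open>V\<close>.
  Reflexivity makes an (l-1)-set linked even if no edge contains it.\<close>

definition linked :: "'a set \<Rightarrow> bool" where
  "linked U \<longleftrightarrow> (\<forall>A \<in> [U]\<^bsup>(l - 1)\<^esup>. \<forall>B \<in> [U]\<^bsup>(l - 1)\<^esup>. (adj_in U)\<^sup>*\<^sup>* A B)"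

lemma adj_in_mono:
  assumes "adj_in U A B" "U \<subseteq> W"
  shows "adj_in W A B"
proof -
  obtain e where "e \<in> E" "e \<subseteq> U" "A \<subseteq> e" "B \<subseteq> e"
    using assms(1) unfolding adj_in_def by auto
  moreover have "A \<in> [W]\<^bsup>(l - 1)\<^esup>" "B \<in> [W]\<^bsup>(l - 1)\<^esup>"
    using assms nsets_mono[of U W "l - 1"] unfolding adj_in_def by auto
  ultimately show ?thesis
    unfolding adj_in_def using assms(2) by (intro conjI bexI[of _ e]) auto
qed

lemma adj_in_rtranclp_mono:
  assumes "(adj_in U)\<^sup>*\<^sup>* A B" "U \<subseteq> W"
  shows "(adj_in W)\<^sup>*\<^sup>* A B"
  using assms(1)
proof induction
  case base
  show ?case by simp
next
  case (step B C)
  show ?case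
    by (rule rtranclp.rtrancl_into_rtrancl[OF step.IH adj_in_mono[OF step.hyps(2) assms(2)]])
qed

lemma adj_in_sym: "adj_in U A B \<Longrightarrow> adj_in U B A"
  unfolding adj_in_def by auto

lemma adj_in_rtranclp_sym:
  assumes "(adj_in U)\<^sup>*\<^sup>* A B"
  shows "(adj_in U)\<^sup>*\<^sup>* B A"
  using symp_rtranclp[OF sympI[OF adj_in_sym]] assms by (rule sympD)

lemma edge_eq_insert:
  assumes "e \<in> E" "A \<subseteq> e" "card A = l - 1"
  obtains w where "w \<notin> A" "e = insert w A"
proof -
  have "card (e - A) = 1"
    using assms edgeD[OF assms(1)] l_ge by (simp add: card_Diff_subset finite_subset)
  then obtain w where "e - A = {w}" by (rule card_1_singletonE)
  then show thesis using that assms(2) by blast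
qed

section \<open>The link of a vertex outside a linked set\<close>

definition link_edge :: "'a set \<Rightarrow> 'a \<Rightarrow> 'a set \<Rightarrow> bool" where
  "link_edge U v e \<longleftrightarrow> e \<in> E \<and> e \<subseteq> U \<and> (\<exists>x\<in>e. insert v (e - {x}) \<in> E)"

text \<open>The link of \<open>v\<close> alone need not be invariant under \<open>adj_in U\<close>,
  since a link edge may have one (l-1)-subset outside it; adding the subsets of link edges repairs
  this.\<close>

definition near_link :: "'a set \<Rightarrow> 'a \<Rightarrow> 'a set \<Rightarrow> bool" where
  "near_link U v A \<longleftrightarrow> insert v A \<in> E \<or> (\<exists>e. link_edge U v e \<and> A \<subseteq> e)"

context
  fixes U :: "'a set" and v :: 'a
  assumes U: "U \<subseteq> V" and v: "v \<in> V" "v \<notin> U"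
begin

text \<open>The (l+1)-set \<open>insert v e\<close> contains \<open>e\<close> and a second edge
  through \<open>v\<close>, so at most one (l-1)-subset of \<open>e\<close> is outside the link of
  \<open>v\<close>.\<close>

lemma link_edge_other:
  assumes e: "link_edge U v e"
    and xy: "x \<in> e" "y \<in> e" "x \<noteq> y" "insert v (e - {x}) \<notin> E"
  shows "insert v (e - {y}) \<in> E"
proof -
  obtain z where z: "e \<in> E" "e \<subseteq> U" "z \<in> e" "insert v (e - {z}) \<in> E"
    using e by (auto simp: link_edge_def)
  have ve: "v \<notin> e" using z v by blast
  have eq: "insert v e - {t} = insert v (e - {t})" if "t \<in> e" for t
    using that ve by blast
  have "insert v e \<in> [V]\<^bsup>(l + 1)\<^esup>"
    using edgeD[OF z(1)] v ve by (auto simp: nsets_def)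
  moreover have "insert v e - {v} \<in> E"
    using z ve by simp
  ultimately show ?thesis
    using at_most_one_nonedge[of "insert v e" v z x y] z xy ve eq by auto
qed

text \<open>The critical case is a step through an edge \<open>f\<close> with no (l-1)-subset in the
  link. Then \<open>A\<close> lies in a link edge \<open>e\<close>, and dispersity is applied to the
  union of \<open>e\<close> and \<open>f\<close>, then to that union with one vertex exchanged for
  \<open>v\<close>.\<close>

lemma near_link_step:
  assumes "near_link U v A" and "adj_in U A B"
  shows "near_link U v B"
proof -
  obtain f where f: "f \<in> E" "f \<subseteq> U" "A \<subseteq> f" "B \<subseteq> f"
    and A: "card A = l - 1" "finite A" and B: "card B = l - 1" "finite B"
    using assms(2) by (auto simp: adj_in_def nsets_def)
  obtain w where w: "w \<notin> A" "f = insert w A"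
    using edge_eq_insert f A by metis
  obtain b where b: "b \<notin> B" "f = insert b B"
    using edge_eq_insert f B by metis
  show ?thesis
  proof (cases "link_edge U v f \<or> A = B")
    case True
    then show ?thesis using f assms(1) by (auto simp: near_link_def)
  next
    case False
    then have nf: "\<not> link_edge U v f" and AB: "A \<noteq> B" by auto
    have nfx: "insert v (f - {x}) \<notin> E" if "x \<in> f" for x
      using nf f that by (auto simp: link_edge_def)
    have fw: "f - {w} = A" using w by auto
    have "insert v A \<notin> E" using nfx[of w] fw w by auto
    then obtain e where e: "link_edge U v e" "A \<subseteq> e"
      using assms(1) by (auto simp: near_link_def)
    then have eE: "e \<in> E" "e \<subseteq> U" by (auto simp: link_edge_def)
    obtain q where q: "q \<notin> A" "e = insert q A"
      using edge_eq_insert eE e A by metis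
    have qw: "q \<noteq> w" using q w nf e by auto
    have Bf: "B = f - {b}" using b by auto
    then have "b \<noteq> w" using AB fw by auto
    then have bA: "b \<in> A" using w b by auto
    have "insert v (e - {q}) \<notin> E"
      using \<open>insert v A \<notin> E\<close> q by simp
    \<comment> \<open>\<open>A\<close> is the single exception in the link edge
      \<open>e\<close>.\<close>
    then have ea: "insert v (e - {a}) \<in> E" if "a \<in> A" for a
      using link_edge_other[OF e(1), of q a] q that by auto
    \<comment> \<open>\<open>X\<close> is the union of the edges \<open>e\<close> and
      \<open>f\<close>, so at most one \<open>X - {x}\<close> is a non-edge.\<close>
    define X where "X = insert q (insert w A)"
    have X: "X \<in> [V]\<^bsup>(l + 1)\<^esup>" "X \<subseteq> U"
      using A q w qw eE f U l_ge by (auto simp: X_def nsets_def)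
    have Xq: "X - {q} = f" and Xw: "X - {w} = e"
      using q w qw by (auto simp: X_def)
    have link_X: "link_edge U v (X - {a})" if "a \<in> A" "X - {a} \<in> E" for a
    proof -
      have "X - {a} - {w} = e - {a}" using Xw by auto
      moreover have "w \<in> X - {a}" using that w by (auto simp: X_def)
      ultimately show ?thesis
        using ea that X(2) by (auto simp: link_edge_def intro!: bexI[of _ w])
    qed
    show ?thesis
    proof (cases "X - {b} \<in> E")
      case True
      then have "link_edge U v (X - {b})" using link_X bA by blast
      moreover have "B \<subseteq> X - {b}" using Bf Xq by auto
      ultimately show ?thesis by (auto simp: near_link_def)
    next
      case nb: False
      \<comment> \<open>As \<open>X - {b}\<close> is the only non-edge, any other vertex
        \<open>a\<close> of \<open>A\<close> gives an edge; one exists because \<open>l - 1\<close>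
        is at least 2.\<close>
      have "\<not> A \<subseteq> {b}"
        using A l_ge card_mono[of "{b}" A] by auto
      then obtain a where a: "a \<in> A" "a \<noteq> b" by auto
      have "X - {a} \<in> E"
        using at_most_one_nonedge[OF X(1), of q w b a] qw nb a bA Xq Xw f eE by (auto simp: X_def)
      then have la: "link_edge U v (X - {a})" using link_X a by blast
      \<comment> \<open>The set \<open>f - {a}\<close> uses up the single exception of the link edge
        \<open>X - {a}\<close>, so \<open>X - {a} - {b}\<close> is in the link.\<close>
      have "X - {a} - {q} = f - {a}" using Xq by auto
      then have "insert v (X - {a} - {q}) \<notin> E" using nfx a w by auto
      then have ab: "insert v (X - {a} - {b}) \<in> E"
        using link_edge_other[OF la, of q b] a bA q by (auto simp: X_def)
      \<comment> \<open>Deleting \<open>w\<close> or \<open>a\<close> from \<open>Y\<close> leaves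
        an edge and deleting \<open>v\<close> does not, so deleting \<open>q\<close> must; this puts
        \<open>f - {b}\<close> in the link, a contradiction.\<close>
      define Y where "Y = insert v (X - {b})"
      have vX: "v \<notin> X" using X v by auto
      have bX: "b \<in> X" using bA by (auto simp: X_def)
      have "Y \<in> [V]\<^bsup>(l + 1)\<^esup>"
        using X v vX bX by (auto simp: Y_def nsets_def)
      moreover have "Y - {w} = insert v (e - {b})" "Y - {a} = insert v (X - {a} - {b})"
        "Y - {q} = insert v (f - {b})" "Y - {v} = X - {b}"
        using vX Xw Xq a by (auto simp: Y_def X_def)
      moreover have "w \<in> Y" "a \<in> Y" "q \<in> Y" "v \<in> Y" "w \<noteq> a" "v \<noteq> q"
        using a bA q w vX by (auto simp: Y_def X_def)
      ultimately have "insert v (f - {b}) \<in> E"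
        using at_most_one_nonedge[of Y w a v q] ea[OF bA] ab nb by auto
      then show ?thesis using nfx w bA by auto
    qed
  qed
qed

text \<open>If \<open>A\<close> is not in the link, it is the exception in a link edge
  \<open>e\<close>; removing from \<open>e\<close> a vertex of \<open>A\<close> outside
  \<open>B\<close> then gives \<open>D\<close>.\<close>

lemma near_link_subset_link:
  assumes A: "near_link U v A" "A \<in> [U]\<^bsup>(l - 1)\<^esup>"
    and B: "B \<subset> A"
  obtains D where "D \<in> [U]\<^bsup>(l - 1)\<^esup>" "B \<subseteq> D" "insert v D \<in> E"
proof (cases "insert v A \<in> E")
  case True
  then show thesis using that A B by blast
next
  case False
  then obtain e where e: "link_edge U v e" "A \<subseteq> e"
    using A by (auto simp: near_link_def)
  then have eE: "e \<in> E" "e \<subseteq> U" by (auto simp: link_edge_def)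
  have cA: "card A = l - 1" using A by (auto simp: nsets_def)
  obtain q where q: "q \<notin> A" "e = insert q A"
    using edge_eq_insert[OF eE(1) e(2) cA] by blast
  obtain a where a: "a \<in> A" "a \<notin> B" using B by auto
  have "e - {q} = A" using q by auto
  then have "insert v (e - {a}) \<in> E"
    using link_edge_other[OF e(1), of q a] q a False by auto
  moreover have "e - {a} \<in> [U]\<^bsup>(l - 1)\<^esup>"
    using edgeD[OF eE(1)] eE a q by (auto simp: nsets_def)
  moreover have "B \<subseteq> e - {a}" using B a e by auto
  ultimately show thesis using that by blast
qed

text \<open>Sets avoiding \<open>v\<close> are joined inside \<open>U\<close>. A set
  \<open>C\<close> containing \<open>v\<close> is adjacent to any link set \<open>D\<close>
  containing \<open>C - {v}\<close>, through the edge \<open>insert v D\<close>.\<close>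

lemma linked_insert:
  assumes "linked U" and A0: "A0 \<in> [U]\<^bsup>(l - 1)\<^esup>" "insert v A0 \<in> E"
  shows "linked (insert v U)"
proof -
  have near: "near_link U v A" if "A \<in> [U]\<^bsup>(l - 1)\<^esup>" for A
  proof -
    have "(adj_in U)\<^sup>*\<^sup>* A0 A"
      using assms that by (auto simp: linked_def)
    then show ?thesis
      by induction (use A0 near_link_step in \<open>auto simp: near_link_def\<close>)
  qed
  have in_U: "(adj_in (insert v U))\<^sup>*\<^sup>* A0 D" if "D \<in> [U]\<^bsup>(l - 1)\<^esup>" for D
    using assms that adj_in_rtranclp_mono[of U A0 D "insert v U"] by (auto simp: linked_def)
  have reach: "(adj_in (insert v U))\<^sup>*\<^sup>* A0 C" if C: "C \<in> [insert v U]\<^bsup>(l - 1)\<^esup>" for C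
  proof (cases "v \<in> C")
    case False
    then show ?thesis using C in_U by (auto simp: nsets_def)
  next
    case True
    let ?B = "C - {v}"
    have B: "?B \<subseteq> U" "finite ?B" "card ?B = l - 2"
      using C True by (auto simp: nsets_def)
    \<comment> \<open>By size, \<open>A0\<close> supplies a vertex completing \<open>?B\<close> to
      an (l-1)-subset of \<open>U\<close>.\<close>
    have "\<not> A0 \<subseteq> ?B"
      using B A0 l_ge card_mono[of ?B A0] by (auto simp: nsets_def)
    then obtain u where u: "u \<in> A0" "u \<notin> ?B" by auto
    have "insert u ?B \<in> [U]\<^bsup>(l - 1)\<^esup>"
      using B u A0 l_ge by (auto simp: nsets_def card_insert_if simp del: card_Diff_insert)
    then obtain D where D: "D \<in> [U]\<^bsup>(l - 1)\<^esup>" "?B \<subseteq> D" "insert v D \<in> E"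
      using near_link_subset_link[OF near, of "insert u ?B" ?B] u by blast
    have "adj_in (insert v U) D C"
      using D C by (auto simp: adj_in_def nsets_def intro!: bexI[of _ "insert v D"])
    then show ?thesis using in_U[OF D(1)] by simp
  qed
  then show ?thesis
    unfolding linked_def by (meson adj_in_rtranclp_sym rtranclp_trans)
qed

end

section \<open>Maximal linked sets\<close>

lemma closed_linked_superset:
  assumes A: "A \<in> [V]\<^bsup>(l - 1)\<^esup>"
  obtains U where "A \<subseteq> U" "U \<subseteq> V" "linked U"
    "\<And>B C. B \<subseteq> U \<Longrightarrow> adj_in V B C \<Longrightarrow> C \<subseteq> U"
proof -
  define S where "S = {U. A \<subseteq> U \<and> U \<subseteq> V \<and> linked U}"
  have "B = A" if "B \<in> [A]\<^bsup>(l - 1)\<^esup>" for B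
    using that A card_subset_eq[of A B] by (auto simp: nsets_def)
  then have "linked A"
    unfolding linked_def by blast
  then have "A \<in> S"
    using A by (auto simp: S_def nsets_def)
  moreover have "finite S"
    using finite_V by (auto simp: S_def intro: finite_subset[of _ "Pow V"])
  ultimately obtain U where U: "U \<in> S" and max: "\<And>W. W \<in> S \<Longrightarrow> U \<subseteq> W \<Longrightarrow> U = W"
    using finite_has_maximal2[of S A] by auto
  have "C \<subseteq> U" if B: "B \<subseteq> U" and adj: "adj_in V B C" for B C
  proof -
    obtain e where e: "e \<in> E" "B \<subseteq> e" "C \<subseteq> e" and cB: "card B = l - 1" "finite B"
      using adj by (auto simp: adj_in_def nsets_def)
    obtain v where v: "e = insert v B"
      using edge_eq_insert[OF e(1,2) cB(1)] by blast
    \<comment> \<open>Otherwise \<open>B\<close> is in the link of \<open>v\<close>, and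
      \<open>insert v U\<close> is a larger linked set.\<close>
    have "v \<in> U"
    proof (rule ccontr)
      assume "v \<notin> U"
      moreover have "v \<in> V" using e v edgeD by blast
      ultimately have "insert v U \<in> S"
        using linked_insert[of U v B] U B cB e v by (auto simp: S_def nsets_def)
      then show False using max[of "insert v U"] \<open>v \<notin> U\<close> by auto
    qed
    then show ?thesis using v e B by auto
  qed
  moreover have "A \<subseteq> U" "U \<subseteq> V" "linked U"
    using U by (auto simp: S_def)
  ultimately show thesis using that by blast
qed

section \<open>Tight walks and tight components\<close>

lemma tight_walk_adj_in:
  assumes "tight_walk l E es" "A \<in> [V]\<^bsup>(l - 1)\<^esup>" "B \<in> [V]\<^bsup>(l - 1)\<^esup>"
    "A \<subseteq> hd es" "B \<subseteq> last es"
  shows "(adj_in V)\<^sup>*\<^sup>* A B"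
  using assms
proof (induction es arbitrary: A)
  case Nil
  then show ?case by (simp add: tight_walk_def)
next
  case (Cons e es)
  have e: "e \<in> E" using Cons.prems by (auto simp: tight_walk_def)
  show ?case
  proof (cases "es = []")
    case True
    then have "adj_in V A B"
      using Cons.prems e edgeD[OF e] by (auto simp: adj_in_def)
    then show ?thesis by simp
  next
    case False
    have walk: "tight_walk l E es"
      unfolding tight_walk_def
    proof (intro conjI allI impI)
      show "es \<noteq> []" by (fact False)
      show "set es \<subseteq> E" using Cons.prems by (auto simp: tight_walk_def)
      fix i assume "i + 1 < length es"
      then have "Suc i + 1 < length (e # es)" by simp
      then have "l - 1 \<le> card ((e # es) ! Suc i \<inter> (e # es) ! (Suc i + 1))"
        using Cons.prems(1) unfolding tight_walk_def by blast
      then show "l - 1 \<le> card (es ! i \<inter> es ! (i + 1))" by simp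
    qed
    have "0 + 1 < length (e # es)" using False by simp
    then have "l - 1 \<le> card ((e # es) ! 0 \<inter> (e # es) ! (0 + 1))"
      using Cons.prems(1) unfolding tight_walk_def by blast
    then have "l - 1 \<le> card (e \<inter> hd es)"
      using False by (simp add: hd_conv_nth)
    \<comment> \<open>An (l-1)-set shared by the first two edges is the next set in the
      chain.\<close>
    then obtain D where D: "D \<subseteq> e \<inter> hd es" "card D = l - 1"
      by (meson obtain_subset_with_card_n)
    then have DV: "D \<in> [V]\<^bsup>(l - 1)\<^esup>"
      using edgeD[OF e] by (auto simp: nsets_def intro: finite_subset)
    then have "adj_in V A D"
      using Cons.prems e edgeD[OF e] D by (auto simp: adj_in_def)
    moreover have "(adj_in V)\<^sup>*\<^sup>* D B"
      using Cons.IH[OF walk DV] Cons.prems D False by auto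
    ultimately show ?thesis by simp
  qed
qed

text \<open>Each adjacency contributes one edge, and consecutive edges share an (l-1)-set. The empty
  chain gives no walk, hence the alternative \<open>A = B\<close>.\<close>

lemma adj_in_tight_walk:
  assumes "(adj_in V)\<^sup>*\<^sup>* A B"
  shows "A = B \<or> (\<exists>es. tight_walk l E es \<and> A \<subseteq> hd es \<and> B \<subseteq> last es)"
  using assms
proof (induction rule: converse_rtranclp_induct)
  case base
  then show ?case by simp
next
  case (step A D)
  obtain e where e: "e \<in> E" "A \<subseteq> e" "D \<subseteq> e" and cD: "card D = l - 1"
    using step(1) by (auto simp: adj_in_def nsets_def)
  from step.IH show ?case
  proof
    assume "D = B"
    then have "tight_walk l E [e] \<and> A \<subseteq> hd [e] \<and> B \<subseteq> last [e]"
      using e by (simp add: tight_walk_def)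
    then show ?thesis by blast
  next
    assume "\<exists>es. tight_walk l E es \<and> D \<subseteq> hd es \<and> B \<subseteq> last es"
    then obtain es where es: "tight_walk l E es" "D \<subseteq> hd es" "B \<subseteq> last es" by blast
    have ne: "es \<noteq> []" using es by (simp add: tight_walk_def)
    have "l - 1 \<le> card (e \<inter> hd es)"
      using cD card_mono[of "e \<inter> hd es" D] edgeD[OF e(1)] e es by simp
    then have "tight_walk l E (e # es)"
      using es(1) e(1) ne
      by (auto simp: tight_walk_def nth_Cons hd_conv_nth split: nat.split)
    then have "tight_walk l E (e # es) \<and> A \<subseteq> hd (e # es) \<and> B \<subseteq> last (e # es)"
      using e es ne by simp
    then show ?thesis by blast
  qed
qed

lemma tightly_connected_iff:
  assumes "A \<in> [V]\<^bsup>(l - 1)\<^esup>" "B \<in> [V]\<^bsup>(l - 1)\<^esup>"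
  shows "(A, B) \<in> tightly_connected l V E \<longleftrightarrow> (adj_in V)\<^sup>*\<^sup>* A B"
  using assms tight_walk_adj_in adj_in_tight_walk
  unfolding tightly_connected_def by blast

text \<open>For a maximal linked \<open>U\<close> around a representative, closure keeps the class
  inside \<open>U\<close> and linkedness makes it all of the (l-1)-subsets.\<close>

lemma tight_component_complete:
  assumes "C \<in> tight_components l V E"
  obtains U where "U \<subseteq> V" "C = [U]\<^bsup>(l - 1)\<^esup>"
proof -
  obtain A where A: "A \<in> [V]\<^bsup>(l - 1)\<^esup>" and C: "C = tightly_connected l V E `` {A}"
    using assms by (auto simp: tight_components_def elim: quotientE)
  obtain U where U: "A \<subseteq> U" "U \<subseteq> V" "linked U"
    and closed: "\<And>B C. B \<subseteq> U \<Longrightarrow> adj_in V B C \<Longrightarrow> C \<subseteq> U"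
    using closed_linked_superset[OF A] by blast
  have AU: "A \<in> [U]\<^bsup>(l - 1)\<^esup>" using A U by (auto simp: nsets_def)
  have "B \<in> [U]\<^bsup>(l - 1)\<^esup>" if "B \<in> C" for B
  proof -
    have B: "B \<in> [V]\<^bsup>(l - 1)\<^esup>" and "(A, B) \<in> tightly_connected l V E"
      using that C by (auto simp: tightly_connected_def)
    then have "(adj_in V)\<^sup>*\<^sup>* A B" using tightly_connected_iff A by blast
    then have "B \<subseteq> U" by induction (use U closed in auto)
    then show ?thesis using B by (auto simp: nsets_def)
  qed
  moreover have "B \<in> C" if B: "B \<in> [U]\<^bsup>(l - 1)\<^esup>" for B
  proof -
    have "(adj_in V)\<^sup>*\<^sup>* A B"
      using U AU B adj_in_rtranclp_mono[of U A B V] by (auto simp: linked_def)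
    moreover have "B \<in> [V]\<^bsup>(l - 1)\<^esup>" using B U by (auto simp: nsets_def)
    ultimately show ?thesis using C A tightly_connected_iff by blast
  qed
  ultimately show thesis using that U by blast
qed

end

theorem theorem1p5:
  fixes l :: nat and V :: "'a set" and E :: "'a set set"
  assumes "l \<ge> 3"
    and "uniform_hypergraph l V E"
    and "disperse l V E"
  shows "\<forall>C \<in> tight_components l V E. \<exists>U. U \<subseteq> V \<and> C = [U]\<^bsup>(l - 1)\<^esup>"
proof -
  interpret disperse_hypergraph l V E
    by unfold_locales (fact assms)+
  show ?thesis by (meson tight_component_complete)
qed

end
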